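(* (1) Let $R$ and $S$ be commutative rings with identity and let $P$ be a $0$-prime ideal of $R$. Then $P \times S$ is an $I$-prime ideal of $R \times S$ for each ideal $I$ of $R \times S$ with $\bigcap_{i=1}^{\infty} (P \times S)^i \subseteq I(P \times S) \subseteq P \times S$. (2) Let $P$ be a finitely generated proper ideal of a commutative ring $R$ with identity. Assume $P$ is $I$-prime, where $I$ is an ideal of $R$ with $IP \subseteq P^{3}$. Then either $P$ is $0$-prime, or $P^{2} \neq 0$ is idempotent and $R$ decomposes as $T \times S$, where $S = P^2$, and $P = J \times S$, where $J$ is a $0$-prime ideal of $T$. Thus $P$ is $I'$-prime for every ideal $I'$ of $R$ with $\bigcap_{i=1}^{\infty} P^i \subseteq I'P \subseteq P$.
   Context: All rings are commutative with identity. For an ideal $I$ of a ring $R$, a proper ideal $P$ of $R$ is called $I$-prime if for all $a, b \in R$, $ab \in P - IP$ (that is, $ab \in P$ and $ab \notin IP$) implies $a \in P$ or $b \in P$. "$0$-prime" is the case where $I$ is the zero ideal; this is the same as weakly prime: a proper ideal $P$ such that $0 \neq ab \in P$ implies $a \in P$ or $b \in P$. An ideal $A$ is idempotent if $A^2 = A$. "$R$ decomposes as $T \times S$ where $S = P^2$" means an internal ring decomposition: $R = T \oplus S$ for ideals $T$ and $S = P^2$ of $R$, each being a ring with its own identity (generated by complementary idempotents $1-e$ and $e$ of $R$, respectively), so that $R$ is identified with the product ring $T \times S$. *)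

theory Defs
  imports "HOL-Algebra.Algebra"
begin

definition I_prime :: "('a, 'm) ring_scheme \<Rightarrow> 'a set \<Rightarrow> 'a set \<Rightarrow> bool" where
  "I_prime R I P \<longleftrightarrow>
     ideal P R \<and> P \<noteq> carrier R \<and>
     (\<forall>a\<in>carrier R. \<forall>b\<in>carrier R.
        a \<otimes>\<^bsub>R\<^esub> b \<in> P - ideal_prod R I P \<longrightarrow> a \<in> P \<or> b \<in> P)"

definition zero_prime :: "('a, 'm) ring_scheme \<Rightarrow> 'a set \<Rightarrow> bool" where
  "zero_prime R P \<longleftrightarrow> I_prime R {\<zero>\<^bsub>R\<^esub>} P"

text \<open>In a commutative ring, 0-prime is the same as weakly prime.\<close>

lemma zero_prime_iff_weakly_prime:
  assumes "cring R"
  shows "zero_prime R P \<longleftrightarrow>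
     ideal P R \<and> P \<noteq> carrier R \<and>
     (\<forall>a\<in>carrier R. \<forall>b\<in>carrier R.
        a \<otimes>\<^bsub>R\<^esub> b \<noteq> \<zero>\<^bsub>R\<^esub> \<and> a \<otimes>\<^bsub>R\<^esub> b \<in> P \<longrightarrow> a \<in> P \<or> b \<in> P)"
proof -
  interpret cring R by fact
  have "ideal_prod R {\<zero>\<^bsub>R\<^esub>} P = {\<zero>\<^bsub>R\<^esub>}" if "ideal P R"
    using ideal_prod_commute[OF zeroideal that] ideal_prod_zero[OF that] by simp
  then show ?thesis
    unfolding zero_prime_def I_prime_def by auto
qed

text \<open>The \<open>n\<close>-th power of an ideal is its power in the multiplicative monoid of ideals;
  the zeroth power is the unit ideal \<open>carrier R\<close>.\<close>

definition ideal_pow :: "('a, 'm) ring_scheme \<Rightarrow> 'a set \<Rightarrow> nat \<Rightarrow> 'a set" where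
  "ideal_pow R P n = P [^]\<^bsub>ideals_set R\<^esub> n"

definition finitely_generated_ideal :: "('a, 'm) ring_scheme \<Rightarrow> 'a set \<Rightarrow> bool" where
  "finitely_generated_ideal R P \<longleftrightarrow>
     (\<exists>A. finite A \<and> A \<subseteq> carrier R \<and> P = Idl\<^bsub>R\<^esub> A)"

text \<open>An ideal \<open>A\<close> of \<open>R\<close> regarded as a ring of its own, with the operations of \<open>R\<close>
  but with identity \<open>u\<close> (in general different from the identity of \<open>R\<close>).\<close>

definition ideal_as_ring :: "('a, 'm) ring_scheme \<Rightarrow> 'a set \<Rightarrow> 'a \<Rightarrow> ('a, 'm) ring_scheme" where
  "ideal_as_ring R A u = R\<lparr>carrier := A, one := u\<rparr>"

text \<open>Internal decomposition \<open>R = T \<times> S\<close>: here \<open>e\<close> is the identity of \<open>S\<close> and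
  \<open>1 - e\<close> is the identity of \<open>T\<close>. The last conjunct is the identification
  of \<open>R\<close> with the external product ring.\<close>

definition decomposes_as ::
    "('a, 'm) ring_scheme \<Rightarrow> 'a \<Rightarrow> 'a set \<Rightarrow> 'a set \<Rightarrow> bool" where
  "decomposes_as R e T S \<longleftrightarrow>
     ideal T R \<and> ideal S R \<and>
     e \<in> carrier R \<and> e \<otimes>\<^bsub>R\<^esub> e = e \<and>
     T = PIdl\<^bsub>R\<^esub> (\<one>\<^bsub>R\<^esub> \<ominus>\<^bsub>R\<^esub> e) \<and> S = PIdl\<^bsub>R\<^esub> e \<and>
     T <+>\<^bsub>R\<^esub> S = carrier R \<and> T \<inter> S = {\<zero>\<^bsub>R\<^esub>} \<and>
     cring (ideal_as_ring R T (\<one>\<^bsub>R\<^esub> \<ominus>\<^bsub>R\<^esub> e)) \<and>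
     cring (ideal_as_ring R S e) \<and>
     (\<lambda>(t, s). t \<oplus>\<^bsub>R\<^esub> s) \<in>
       ring_iso (RDirProd (ideal_as_ring R T (\<one>\<^bsub>R\<^esub> \<ominus>\<^bsub>R\<^esub> e)) (ideal_as_ring R S e)) R"

end

theory Submission
  imports Defs
begin

text \<open>
  Both parts rest on the remark that an \<open>I\<close>-prime ideal \<open>P\<close> can fail to be prime only
  through products that lie in \<open>IP\<close>, so that enlarging \<open>IP\<close> inside \<open>P\<close> weakens the condition.

  For a product ring, \<open>(0, 1)\<close> is an idempotent element of \<open>P \<times> S\<close>, hence lies in all powers of
  \<open>P \<times> S\<close>. Therefore \<open>0 \<times> S\<close> lies in the intersection of the powers and so in \<open>I (P \<times> S)\<close>.
  A product \<open>(a, s) (b, t)\<close> in \<open>P \<times> S\<close> but outside \<open>I (P \<times> S)\<close> must then have \<open>ab \<noteq> 0\<close>, and weak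
  primeness of \<open>P\<close> applies to \<open>ab\<close> (\<open>I_prime_times_carrier\<close>).

  Now let \<open>P\<close> be finitely generated and \<open>I\<close>-prime with \<open>IP \<subseteq> P\<^sup>3\<close>, and suppose that it is not weakly
  prime, hence not prime. One pair \<open>a, b\<close> of elements outside \<open>P\<close> with product in \<open>P\<close> forces
  \<open>P\<^sup>2 \<subseteq> IP\<close>: every product \<open>(a + p) (b + q)\<close> with \<open>p, q \<in> P\<close> is a failure of primeness, so it lies in
  \<open>IP\<close>, and \<open>pq\<close> is an alternating sum of four of these (\<open>I_prime_square_subset\<close>). Together with
  \<open>IP \<subseteq> P\<^sup>3 \<subseteq> P\<^sup>2\<close> this gives \<open>P\<^sup>2 = IP = P\<^sup>3\<close>, so \<open>P\<^sup>2\<close> is idempotent. It is nonzero, as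
  otherwise \<open>IP = 0\<close> and \<open>P\<close> would be weakly prime.

  A finitely generated idempotent ideal is generated by an idempotent element \<open>e\<close>
  (\<open>finitely_generated_idempotent_ideal_principal\<close>, a form of Nakayama's lemma), and \<open>e\<close> splits the
  ring (\<open>decomposes_as_idempotent\<close>). In the factor \<open>T\<close> generated by \<open>1 - e\<close> the ideal \<open>J = P \<inter> T\<close>
  is weakly prime, because \<open>T\<close> meets \<open>P\<^sup>2 = IP\<close> only in \<open>0\<close> (\<open>zero_prime_component\<close>).
  Finally, all powers of \<open>P\<close> from the second on equal \<open>IP\<close>, so an ideal \<open>I'\<close> for which \<open>I'P\<close> contains
  their intersection has \<open>IP \<subseteq> I'P\<close>, and \<open>I'\<close>-primeness follows by the initial remark.
\<close>

section \<open>Finitely generated ideals\<close>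

text \<open>
  Products of generators control all products because, for an ideal \<open>K\<close>, the elements carried
  into \<open>K\<close> by multiplication with a fixed element form an ideal. This is used once for each factor.
\<close>

lemma (in cring) genideal_prod_genideal:
  assumes A: "A \<subseteq> carrier R" and B: "B \<subseteq> carrier R"
  shows "(Idl A) \<cdot> (Idl B) = Idl (A <#> B)"
proof
  have AB: "A <#> B \<subseteq> carrier R"
    using A B by (auto simp: set_mult_def)
  interpret K: ideal "Idl (A <#> B)" R
    by (rule genideal_ideal[OF AB])
  have mem: "a \<otimes> b \<in> Idl (A <#> B)" if "a \<in> A" "b \<in> B" for a b
    using genideal_self[OF AB] that unfolding set_mult_def by blast
  have gen: "Idl B \<subseteq> {y \<in> carrier R. a \<otimes> y \<in> Idl (A <#> B)}" if "a \<in> A" for a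
  proof (rule genideal_minimal)
    show "ideal {y \<in> carrier R. a \<otimes> y \<in> Idl (A <#> B)} R"
      using K.helper_max_prime[OF is_cring] that A by auto
    show "B \<subseteq> {y \<in> carrier R. a \<otimes> y \<in> Idl (A <#> B)}"
      using that B mem by blast
  qed
  have all: "Idl A \<subseteq> {x \<in> carrier R. y \<otimes> x \<in> Idl (A <#> B)}" if "y \<in> Idl B" for y
  proof (rule genideal_minimal)
    have y: "y \<in> carrier R"
      by (rule ideal.Icarr[OF genideal_ideal[OF B] that])
    show "ideal {x \<in> carrier R. y \<otimes> x \<in> Idl (A <#> B)} R"
      using K.helper_max_prime[OF is_cring] y by auto
    show "A \<subseteq> {x \<in> carrier R. y \<otimes> x \<in> Idl (A <#> B)}"
    proof
      fix x assume x: "x \<in> A"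
      then have "x \<in> carrier R" "x \<otimes> y \<in> Idl (A <#> B)"
        using gen[OF x] that A by auto
      then show "x \<in> {x \<in> carrier R. y \<otimes> x \<in> Idl (A <#> B)}"
        using m_comm y by simp
    qed
  qed
  show "(Idl A) \<cdot> (Idl B) \<subseteq> Idl (A <#> B)"
  proof
    fix z assume "z \<in> (Idl A) \<cdot> (Idl B)"
    then show "z \<in> Idl (A <#> B)"
    proof (induction rule: ideal_prod.induct)
      case (prod i j)
      then have "i \<in> carrier R" "j \<in> carrier R"
        using ideal.Icarr[OF genideal_ideal[OF A]] ideal.Icarr[OF genideal_ideal[OF B]] by auto
      then show ?case
        using all[OF prod(2)] prod(1) m_comm by auto
    next
      case (sum s t)
      then show ?case by simp
    qed
  qed
next
  show "Idl (A <#> B) \<subseteq> (Idl A) \<cdot> (Idl B)"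
  proof (rule genideal_minimal)
    show "ideal ((Idl A) \<cdot> (Idl B)) R"
      by (intro ideal_prod_is_ideal genideal_ideal A B)
    show "A <#> B \<subseteq> (Idl A) \<cdot> (Idl B)"
      using genideal_self[OF A] genideal_self[OF B]
      by (auto simp: set_mult_def intro!: ideal_prod.prod)
  qed
qed

lemma (in cring) finitely_generated_ideal_prod:
  assumes "finitely_generated_ideal R P" "finitely_generated_ideal R Q"
  shows "finitely_generated_ideal R (P \<cdot> Q)"
proof -
  obtain A B where A: "finite A" "A \<subseteq> carrier R" "P = Idl A"
    and B: "finite B" "B \<subseteq> carrier R" "Q = Idl B"
    using assms unfolding finitely_generated_ideal_def by blast
  have "A <#> B = (\<lambda>(a, b). a \<otimes> b) ` (A \<times> B)"
    by (auto simp: set_mult_def)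
  then have "finite (A <#> B)" "A <#> B \<subseteq> carrier R"
    using A B by auto
  then show ?thesis
    using genideal_prod_genideal[OF A(2) B(2)] A B
    unfolding finitely_generated_ideal_def by blast
qed

lemma (in cring) mem_genideal_insertE:
  assumes "z \<in> Idl (insert x B)" "x \<in> carrier R" "B \<subseteq> carrier R"
  obtains r b where "r \<in> carrier R" "b \<in> Idl B" "z = r \<otimes> x \<oplus> b"
proof -
  have iB: "ideal (Idl B) R" and ix: "ideal (PIdl x) R"
    using assms genideal_ideal cgenideal_ideal by auto
  have "insert x B \<subseteq> (PIdl x) \<union> (Idl B)"
    using genideal_self assms(3) cgenideal_self[OF assms(2)] by auto
  also have "\<dots> \<subseteq> Idl ((PIdl x) \<union> (Idl B))"
    by (rule genideal_self) (use ideal.Icarr[OF iB] ideal.Icarr[OF ix] in blast)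
  finally have "Idl (insert x B) \<subseteq> (PIdl x) <+> (Idl B)"
    using genideal_minimal[OF add_ideals[OF ix iB]] union_genideal[OF ix iB] by simp
  then have "z \<in> (PIdl x) <+> (Idl B)"
    using assms(1) by blast
  then show thesis
    using that by (auto simp: set_add_def' cgenideal_def)
qed

text \<open>
  This is the inductive core of Nakayama's lemma in the case \<open>Q = Q\<^sup>2\<close>, done by removing generators
  one at a time instead of by a determinant. If \<open>(1 - q) Q\<close> lies in the ideal generated by \<open>x\<close> and
  \<open>B\<close>, then \<open>Q = Q\<^sup>2\<close> yields \<open>(1 - q) Q \<subseteq> Q x + (B)\<close>, now with coefficients of \<open>x\<close> in \<open>Q\<close>. Taking
  \<open>x\<close> itself gives \<open>(1 - q) x = a x + b\<close> with \<open>a \<in> Q\<close> and \<open>b \<in> (B)\<close>, so \<open>1 - q - a\<close> multiplies \<open>x\<close> into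
  \<open>(B)\<close>, and the element \<open>(1 - q - a) (1 - q)\<close>, still congruent to \<open>1\<close> modulo \<open>Q\<close>, multiplies
  all of \<open>Q\<close> into \<open>(B)\<close>.
\<close>

lemma (in cring) idempotent_ideal_eliminate_generators:
  assumes "finite B" "ideal Q R" "Q \<cdot> Q = Q" "B \<subseteq> Q" "q \<in> Q"
    and "\<And>m. m \<in> Q \<Longrightarrow> (\<one> \<ominus> q) \<otimes> m \<in> Idl B"
  shows "\<exists>q'\<in>Q. \<forall>m\<in>Q. (\<one> \<ominus> q') \<otimes> m = \<zero>"
  using assms
proof (induction B arbitrary: q rule: finite_induct)
  case empty
  have "Idl ({}) \<subseteq> {\<zero>}"
    by (rule genideal_minimal) (auto intro: zeroideal)
  then show ?case
    using empty by blast
next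
  case (insert x B)
  interpret Q: ideal Q R by fact
  have x: "x \<in> Q" "x \<in> carrier R" and BQ: "B \<subseteq> Q" and B: "B \<subseteq> carrier R"
    using insert.prems Q.a_subset by auto
  interpret K: ideal "Idl B" R
    by (rule genideal_ideal[OF B])
  have q: "q \<in> carrier R"
    using insert.prems by simp
  have split: "\<exists>a\<in>Q. \<exists>b\<in>Idl B. (\<one> \<ominus> q) \<otimes> m = a \<otimes> x \<oplus> b" if "m \<in> Q" for m
  proof -
    have "m \<in> Q \<cdot> Q"
      using that insert.prems by simp
    then show ?thesis
    proof (induction rule: ideal_prod.induct)
      case (prod u v)
      then have uv: "u \<in> carrier R" "v \<in> carrier R" by auto
      obtain r b where rb: "r \<in> carrier R" "b \<in> Idl B" "(\<one> \<ominus> q) \<otimes> v = r \<otimes> x \<oplus> b"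
        using mem_genideal_insertE[OF insert.prems(5)[OF prod(2)] x(2) B] by blast
      have b: "b \<in> carrier R" using rb(2) by (rule K.Icarr)
      have "(\<one> \<ominus> q) \<otimes> (u \<otimes> v) = u \<otimes> ((\<one> \<ominus> q) \<otimes> v)"
        using uv q by algebra
      also have "\<dots> = (u \<otimes> r) \<otimes> x \<oplus> u \<otimes> b"
        unfolding rb(3) using uv rb(1) x(2) b by algebra
      finally show ?case
        using prod(1) rb uv K.I_l_closed Q.I_r_closed by blast
    next
      case (sum s t)
      then obtain a b c d where abcd: "a \<in> Q" "b \<in> Idl B" "c \<in> Q" "d \<in> Idl B"
        "(\<one> \<ominus> q) \<otimes> s = a \<otimes> x \<oplus> b" "(\<one> \<ominus> q) \<otimes> t = c \<otimes> x \<oplus> d"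
        by blast
      have st: "s \<in> carrier R" "t \<in> carrier R"
        using sum(1,2) insert.prems by auto
      have carr: "a \<in> carrier R" "b \<in> carrier R" "c \<in> carrier R" "d \<in> carrier R"
        using abcd by auto
      have "(\<one> \<ominus> q) \<otimes> (s \<oplus> t) = (\<one> \<ominus> q) \<otimes> s \<oplus> (\<one> \<ominus> q) \<otimes> t"
        using st q by algebra
      also have "\<dots> = (a \<oplus> c) \<otimes> x \<oplus> (b \<oplus> d)"
        unfolding abcd using carr x(2) by algebra
      finally show ?case
        using abcd by blast
    qed
  qed
  obtain a b where ab: "a \<in> Q" "b \<in> Idl B" "(\<one> \<ominus> q) \<otimes> x = a \<otimes> x \<oplus> b"
    using split[OF x(1)] by blast
  have abc: "a \<in> carrier R" "b \<in> carrier R"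
    using ab by auto
  have bx: "(\<one> \<ominus> q \<ominus> a) \<otimes> x = b"
  proof -
    have "(\<one> \<ominus> q \<ominus> a) \<otimes> x = (\<one> \<ominus> q) \<otimes> x \<ominus> a \<otimes> x"
      using abc q x(2) by algebra
    then show ?thesis
      unfolding ab(3) using abc x(2) by algebra
  qed
  \<comment> \<open>\<open>1 - q' = (1 - q) (1 - q - a)\<close>, where the second factor turns \<open>x\<close> into an element of \<open>Idl B\<close>.\<close>
  define q' where "q' = q \<oplus> (\<one> \<ominus> q) \<otimes> (q \<oplus> a)"
  have q': "q' \<in> Q"
    unfolding q'_def using insert.prems(4) ab q by (intro Q.a_closed Q.I_l_closed) auto
  have fac: "\<one> \<ominus> q' = (\<one> \<ominus> q \<ominus> a) \<otimes> (\<one> \<ominus> q)"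
    unfolding q'_def using q abc by algebra
  show ?case
  proof (rule insert.IH[OF insert.prems(1,2) BQ q'])
    fix m assume m: "m \<in> Q"
    obtain c d where cd: "c \<in> Q" "d \<in> Idl B" "(\<one> \<ominus> q) \<otimes> m = c \<otimes> x \<oplus> d"
      using split[OF m] by blast
    have carr: "c \<in> carrier R" "d \<in> carrier R" "m \<in> carrier R"
      using cd m by auto
    have "(\<one> \<ominus> q') \<otimes> m = (\<one> \<ominus> q \<ominus> a) \<otimes> ((\<one> \<ominus> q) \<otimes> m)"
      unfolding fac using q abc carr by algebra
    also have "\<dots> = c \<otimes> ((\<one> \<ominus> q \<ominus> a) \<otimes> x) \<oplus> (\<one> \<ominus> q \<ominus> a) \<otimes> d"
      unfolding cd(3) using q abc carr x(2) by algebra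
    finally show "(\<one> \<ominus> q') \<otimes> m \<in> Idl B"
      unfolding bx using ab cd carr q abc
      by (auto intro!: K.a_closed K.I_l_closed)
  qed
qed

text \<open>
  Eliminating all generators, from \<open>q = 0\<close>, produces \<open>e \<in> Q\<close> with \<open>(1 - e) Q = 0\<close>. Such an \<open>e\<close> acts as
  an identity on \<open>Q\<close>; in particular it is idempotent and generates \<open>Q\<close>.
\<close>

lemma (in cring) finitely_generated_idempotent_ideal_principal:
  assumes "finitely_generated_ideal R Q" "Q \<cdot> Q = Q"
  obtains e where "e \<in> carrier R" "e \<otimes> e = e" "Q = PIdl e"
proof -
  obtain A where A: "finite A" "A \<subseteq> carrier R" "Q = Idl A"
    using assms(1) unfolding finitely_generated_ideal_def by blast
  have iQ: "ideal Q R"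
    using A genideal_ideal by simp
  interpret Q: ideal Q R by fact
  have "\<exists>e\<in>Q. \<forall>m\<in>Q. (\<one> \<ominus> e) \<otimes> m = \<zero>"
  proof (rule idempotent_ideal_eliminate_generators[OF A(1) iQ assms(2)])
    show "A \<subseteq> Q"
      using genideal_self A by simp
    show "\<zero> \<in> Q" by simp
    fix m assume "m \<in> Q"
    then show "(\<one> \<ominus> \<zero>) \<otimes> m \<in> Idl A"
      using A(3) Q.Icarr by (simp add: a_minus_def)
  qed
  then obtain e where e: "e \<in> Q" and kill: "\<And>m. m \<in> Q \<Longrightarrow> (\<one> \<ominus> e) \<otimes> m = \<zero>"
    by blast
  have em: "m = m \<otimes> e" if "m \<in> Q" for m
  proof -
    have "m = (\<one> \<ominus> e) \<otimes> m \<oplus> m \<otimes> e"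
      using Q.Icarr[OF that] Q.Icarr[OF e] by algebra
    then show ?thesis
      using kill[OF that] Q.Icarr[OF that] Q.Icarr[OF e] by simp
  qed
  show thesis
  proof (rule that)
    show "e \<in> carrier R" "e \<otimes> e = e"
      using e em by auto
    show "Q = PIdl e"
    proof
      show "Q \<subseteq> PIdl e"
        using em Q.Icarr unfolding cgenideal_def by blast
      show "PIdl e \<subseteq> Q"
        by (rule cgenideal_minimal[OF iQ e])
    qed
  qed
qed

section \<open>The decomposition given by an idempotent\<close>

lemma (in cring) mem_cgenideal_idempotent_iff:
  assumes "e \<in> carrier R" "e \<otimes> e = e"
  shows "x \<in> PIdl e \<longleftrightarrow> x \<in> carrier R \<and> e \<otimes> x = x"
proof
  assume "x \<in> PIdl e"
  then obtain r where "r \<in> carrier R" "x = r \<otimes> e"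
    by (auto simp: cgenideal_def)
  then have "r \<in> carrier R" "x = e \<otimes> r"
    using assms m_comm by auto
  then show "x \<in> carrier R \<and> e \<otimes> x = x"
    using assms by (simp flip: m_assoc)
next
  assume "x \<in> carrier R \<and> e \<otimes> x = x"
  then show "x \<in> PIdl e"
    using assms m_comm[of x e] unfolding cgenideal_def by force
qed

lemma ideal_as_ring_simps [simp]:
  "carrier (ideal_as_ring R A u) = A"
  "monoid.one (ideal_as_ring R A u) = u"
  "monoid.mult (ideal_as_ring R A u) = monoid.mult R"
  "ring.add (ideal_as_ring R A u) = ring.add R"
  "ring.zero (ideal_as_ring R A u) = ring.zero R"
  by (simp_all add: ideal_as_ring_def)

lemma (in cring) cring_ideal_as_ring:
  assumes "ideal A R" "u \<in> A" "\<And>x. x \<in> A \<Longrightarrow> u \<otimes> x = x"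
  shows "cring (ideal_as_ring R A u)"
proof -
  interpret A: ideal A R by fact
  show ?thesis
  proof (intro cringI abelian_groupI comm_monoidI)
    fix x assume "x \<in> carrier (ideal_as_ring R A u)"
    then show "\<exists>y\<in>carrier (ideal_as_ring R A u). y \<oplus>\<^bsub>ideal_as_ring R A u\<^esub> x = \<zero>\<^bsub>ideal_as_ring R A u\<^esub>"
      by (auto intro!: bexI[of _ "\<ominus> x"] simp: l_neg)
  qed (simp_all add: assms(2,3) a_assoc m_assoc l_distr A.I_l_closed, simp_all add: a_comm m_comm)
qed

lemma (in cring) ideal_ideal_as_ring:
  assumes "ideal A R" "u \<in> A" "\<And>x. x \<in> A \<Longrightarrow> u \<otimes> x = x" "ideal J R" "J \<subseteq> A"
  shows "ideal J (ideal_as_ring R A u)"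
proof (rule idealI)
  interpret T: cring "ideal_as_ring R A u"
    by (rule cring_ideal_as_ring) fact+
  interpret A: ideal A R by fact
  interpret J: ideal J R by fact
  show "ring (ideal_as_ring R A u)" by unfold_locales
  show "subgroup J (add_monoid (ideal_as_ring R A u))"
  proof (rule T.add.subgroupI)
    show "J \<subseteq> carrier (ideal_as_ring R A u)" "J \<noteq> {}"
      using assms(5) J.zero_closed by (simp, blast)
    fix x assume x: "x \<in> J"
    then have "x \<in> A" "\<ominus> x \<in> J"
      using assms(5) by auto
    moreover have "\<ominus>\<^bsub>ideal_as_ring R A u\<^esub> x = \<ominus> x"
      by (rule T.minus_equality) (use calculation assms(5) in \<open>auto simp: l_neg A.Icarr\<close>)
    ultimately show "\<ominus>\<^bsub>ideal_as_ring R A u\<^esub> x \<in> J"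
      by simp
  qed auto
qed (auto simp: ideal.Icarr[OF assms(1)] ideal.I_l_closed[OF assms(4)] ideal.I_r_closed[OF assms(4)])

lemma (in cring) idempotent_complement:
  assumes "e \<in> carrier R" "e \<otimes> e = e"
  shows "(\<one> \<ominus> e) \<otimes> (\<one> \<ominus> e) = \<one> \<ominus> e" "e \<otimes> (\<one> \<ominus> e) = \<zero>" "e \<oplus> (\<one> \<ominus> e) = \<one>"
proof -
  have "(\<one> \<ominus> e) \<otimes> (\<one> \<ominus> e) = \<one> \<ominus> e \<ominus> e \<oplus> e \<otimes> e"
    using assms(1) by algebra
  then show "(\<one> \<ominus> e) \<otimes> (\<one> \<ominus> e) = \<one> \<ominus> e"
    unfolding assms(2) using assms(1) by algebra
  have "e \<otimes> (\<one> \<ominus> e) = e \<ominus> e \<otimes> e"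
    using assms(1) by algebra
  then show "e \<otimes> (\<one> \<ominus> e) = \<zero>"
    unfolding assms(2) using assms(1) by algebra
  show "e \<oplus> (\<one> \<ominus> e) = \<one>"
    using assms(1) by algebra
qed

text \<open>
  Multiplication by \<open>e\<close> and by \<open>1 - e\<close> are the two projections. Each kills the other summand since
  \<open>e (1 - e) = 0\<close>, and they add up to the identity since \<open>e + (1 - e) = 1\<close>.
\<close>

lemma (in cring) decomposes_as_idempotent:
  assumes e: "e \<in> carrier R" "e \<otimes> e = e"
  shows "decomposes_as R e (PIdl (\<one> \<ominus> e)) (PIdl e)"
proof -
  define f where "f = \<one> \<ominus> e"
  have f: "f \<in> carrier R" "f \<otimes> f = f" and ef: "e \<otimes> f = \<zero>" "f \<otimes> e = \<zero>" "e \<oplus> f = \<one>"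
    unfolding f_def using idempotent_complement[OF e] e m_comm[of "\<one> \<ominus> e" e] by auto
  note memS = mem_cgenideal_idempotent_iff[OF e]
  note memT = mem_cgenideal_idempotent_iff[OF f]
  have iT: "ideal (PIdl f) R" and iS: "ideal (PIdl e) R"
    using e f by (auto intro: cgenideal_ideal)
  interpret T: ideal "PIdl f" R by fact
  interpret S: ideal "PIdl e" R by fact
  have zT: "e \<otimes> t = \<zero>" if "t \<in> PIdl f" for t
  proof -
    have "e \<otimes> t = e \<otimes> (f \<otimes> t)" using that memT by simp
    also have "\<dots> = (e \<otimes> f) \<otimes> t" using T.Icarr[OF that] e f by (simp only: m_assoc)
    finally show ?thesis using T.Icarr[OF that] ef by simp
  qed
  have zS: "f \<otimes> s = \<zero>" if "s \<in> PIdl e" for s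
  proof -
    have "f \<otimes> s = f \<otimes> (e \<otimes> s)" using that memS by simp
    also have "\<dots> = (f \<otimes> e) \<otimes> s" using S.Icarr[OF that] e f by (simp only: m_assoc)
    finally show ?thesis using S.Icarr[OF that] ef by simp
  qed
  have TS: "t \<otimes> s = \<zero>" "s \<otimes> t = \<zero>" if "t \<in> PIdl f" "s \<in> PIdl e" for t s
  proof -
    have carr: "t \<in> carrier R" "s \<in> carrier R" using that by auto
    have "t \<otimes> s = t \<otimes> (e \<otimes> s)" using that memS by simp
    also have "\<dots> = (e \<otimes> t) \<otimes> s" using carr e by algebra
    finally show "t \<otimes> s = \<zero>" using zT[OF that(1)] carr by simp
    then show "s \<otimes> t = \<zero>" using carr m_comm by simp
  qed
  have proj: "e \<otimes> (t \<oplus> s) = s" "f \<otimes> (t \<oplus> s) = t" if "t \<in> PIdl f" "s \<in> PIdl e" for t s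
    using that zT[OF that(1)] zS[OF that(2)] memT[of t] memS[of s] e(1) f(1)
    by (simp_all add: r_distr)
  have whole: "x = f \<otimes> x \<oplus> e \<otimes> x" "f \<otimes> x \<in> PIdl f" "e \<otimes> x \<in> PIdl e" if "x \<in> carrier R" for x
  proof -
    have "x = (e \<oplus> f) \<otimes> x" using that ef by simp
    then show "x = f \<otimes> x \<oplus> e \<otimes> x" using that e f by (simp add: l_distr a_comm)
    show "f \<otimes> x \<in> PIdl f" "e \<otimes> x \<in> PIdl e"
      unfolding memS memT using that e f by (simp_all flip: m_assoc)
  qed
  have sum: "(PIdl f) <+> (PIdl e) = carrier R"
  proof
    show "(PIdl f) <+> (PIdl e) \<subseteq> carrier R"
      using T.Icarr S.Icarr by (auto simp: set_add_def')
    show "carrier R \<subseteq> (PIdl f) <+> (PIdl e)"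
      using whole by (fastforce simp: set_add_def')
  qed
  have "x = \<zero>" if "x \<in> PIdl f" "x \<in> PIdl e" for x
    using zT[OF that(1)] that(2) memS by simp
  then have inter: "(PIdl f) \<inter> (PIdl e) = {\<zero>}"
    by auto
  have iso: "(\<lambda>(t, s). t \<oplus> s) \<in>
    ring_iso (RDirProd (ideal_as_ring R (PIdl f) f) (ideal_as_ring R (PIdl e) e)) R"
  proof (rule ring_iso_memI)
    show "bij_betw (\<lambda>(t, s). t \<oplus> s)
      (carrier (RDirProd (ideal_as_ring R (PIdl f) f) (ideal_as_ring R (PIdl e) e))) (carrier R)"
    proof (rule bij_betwI')
      fix p p' assume "p \<in> carrier (RDirProd (ideal_as_ring R (PIdl f) f) (ideal_as_ring R (PIdl e) e))"
        "p' \<in> carrier (RDirProd (ideal_as_ring R (PIdl f) f) (ideal_as_ring R (PIdl e) e))"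
      then show "((case p of (t, s) \<Rightarrow> t \<oplus> s) = (case p' of (t, s) \<Rightarrow> t \<oplus> s)) = (p = p')"
        by (auto simp: RDirProd_carrier) (metis proj)+
    next
      fix p assume "p \<in> carrier (RDirProd (ideal_as_ring R (PIdl f) f) (ideal_as_ring R (PIdl e) e))"
      then show "(case p of (t, s) \<Rightarrow> t \<oplus> s) \<in> carrier R"
        by (auto simp: RDirProd_carrier)
    next
      fix x assume "x \<in> carrier R"
      then show "\<exists>p\<in>carrier (RDirProd (ideal_as_ring R (PIdl f) f) (ideal_as_ring R (PIdl e) e)).
          x = (case p of (t, s) \<Rightarrow> t \<oplus> s)"
        using whole[of x] by (intro bexI[of _ "(f \<otimes> x, e \<otimes> x)"]) (auto simp: RDirProd_carrier)
    qed
  next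
    have "(t \<otimes> t') \<oplus> (s \<otimes> s') = (t \<oplus> s) \<otimes> (t' \<oplus> s')"
      if "t \<in> PIdl f" "t' \<in> PIdl f" "s \<in> PIdl e" "s' \<in> PIdl e" for t t' s s'
      using that by (simp add: l_distr r_distr TS)
    then show "(case p \<otimes>\<^bsub>RDirProd (ideal_as_ring R (PIdl f) f) (ideal_as_ring R (PIdl e) e)\<^esub> p' of (t, s) \<Rightarrow> t \<oplus> s)
      = (case p of (t, s) \<Rightarrow> t \<oplus> s) \<otimes> (case p' of (t, s) \<Rightarrow> t \<oplus> s)"
      if "p \<in> carrier (RDirProd (ideal_as_ring R (PIdl f) f) (ideal_as_ring R (PIdl e) e))"
         "p' \<in> carrier (RDirProd (ideal_as_ring R (PIdl f) f) (ideal_as_ring R (PIdl e) e))" for p p'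
      using that by (auto simp: RDirProd_def DirProd_def monoid.defs)
    show "(case p \<oplus>\<^bsub>RDirProd (ideal_as_ring R (PIdl f) f) (ideal_as_ring R (PIdl e) e)\<^esub> p' of (t, s) \<Rightarrow> t \<oplus> s)
      = (case p of (t, s) \<Rightarrow> t \<oplus> s) \<oplus> (case p' of (t, s) \<Rightarrow> t \<oplus> s)"
      if "p \<in> carrier (RDirProd (ideal_as_ring R (PIdl f) f) (ideal_as_ring R (PIdl e) e))"
         "p' \<in> carrier (RDirProd (ideal_as_ring R (PIdl f) f) (ideal_as_ring R (PIdl e) e))" for p p'
      using that by (auto simp: RDirProd_def DirProd_def monoid.defs a_ac)
  qed (use ef e f in \<open>auto simp: RDirProd_def DirProd_def monoid.defs a_comm\<close>)
  have "cring (ideal_as_ring R (PIdl f) f)"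
    by (rule cring_ideal_as_ring[OF iT]) (simp_all add: memT f)
  moreover have "cring (ideal_as_ring R (PIdl e) e)"
    by (rule cring_ideal_as_ring[OF iS]) (simp_all add: memS e)
  ultimately show ?thesis
    unfolding decomposes_as_def f_def[symmetric]
    using iT iS e sum inter iso by (intro conjI refl)
qed

section \<open>Ideals that are prime up to a subideal\<close>

text \<open>
  Adding elements of \<open>P\<close> to \<open>a\<close> and \<open>b\<close> keeps both factors outside \<open>P\<close> and their product inside,
  so \<open>(a + p) (b + q)\<close> must always fall into \<open>IP\<close>. Inclusion-exclusion over \<open>p\<close> or \<open>0\<close> and \<open>q\<close> or \<open>0\<close>
  then isolates \<open>pq\<close>.
\<close>

lemma (in cring) I_prime_square_subset:
  assumes IP: "I_prime R I P" and I: "ideal I R"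
    and ab: "a \<in> carrier R" "b \<in> carrier R" "a \<otimes> b \<in> P" "a \<notin> P" "b \<notin> P"
  shows "P \<cdot> P \<subseteq> I \<cdot> P"
proof -
  have P: "ideal P R"
    using IP by (simp add: I_prime_def)
  interpret P: ideal P R by fact
  interpret K: ideal "I \<cdot> P" R
    by (rule ideal_prod_is_ideal[OF I P])
  have absorb: "x \<otimes> y \<in> I \<cdot> P"
    if "x \<in> carrier R" "y \<in> carrier R" "x \<otimes> y \<in> P" "x \<notin> P" "y \<notin> P" for x y
    using IP that unfolding I_prime_def by blast
  have shift: "x \<oplus> p \<notin> P" if "x \<in> carrier R" "x \<notin> P" "p \<in> P" for x p
  proof
    assume "x \<oplus> p \<in> P"
    then have "(x \<oplus> p) \<ominus> p \<in> P"
      using that by (simp add: a_minus_def)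
    moreover have "(x \<oplus> p) \<ominus> p = x"
      using that(1) P.Icarr[OF that(3)] by algebra
    ultimately show False
      using that by simp
  qed
  have key: "(a \<oplus> p) \<otimes> (b \<oplus> q) \<in> I \<cdot> P" if "p \<in> P" "q \<in> P" for p q
  proof (rule absorb)
    have "(a \<oplus> p) \<otimes> (b \<oplus> q) = a \<otimes> b \<oplus> (a \<otimes> q \<oplus> p \<otimes> (b \<oplus> q))"
      using ab P.Icarr[OF that(1)] P.Icarr[OF that(2)] by algebra
    then show "(a \<oplus> p) \<otimes> (b \<oplus> q) \<in> P"
      using ab that by (simp add: P.I_l_closed P.I_r_closed)
  qed (use ab that shift in auto)
  show ?thesis
  proof
    fix z assume "z \<in> P \<cdot> P"
    then show "z \<in> I \<cdot> P"
    proof (induction rule: ideal_prod.induct)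
      case (prod p q)
      have carr: "p \<in> carrier R" "q \<in> carrier R"
        using prod by auto
      have "p \<otimes> q = (a \<oplus> p) \<otimes> (b \<oplus> q) \<ominus> (a \<oplus> p) \<otimes> (b \<oplus> \<zero>)
          \<ominus> ((a \<oplus> \<zero>) \<otimes> (b \<oplus> q) \<ominus> (a \<oplus> \<zero>) \<otimes> (b \<oplus> \<zero>))"
        using ab carr by algebra
      also have "\<dots> \<in> I \<cdot> P"
        unfolding a_minus_def
        by (intro K.a_closed K.a_inv_closed key prod P.zero_closed)
      finally show ?case .
    next
      case (sum s t)
      then show ?case by simp
    qed
  qed
qed

text \<open>A product outside \<open>IP\<close> is in particular nonzero.\<close>

lemma (in cring) zero_prime_imp_I_prime:
  assumes "zero_prime R P" "ideal I R"
  shows "I_prime R I P"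
proof -
  have "\<zero> \<in> I \<cdot> P"
    using assms ideal_prod_is_ideal additive_subgroup.zero_closed ideal.axioms(1)
    unfolding zero_prime_def I_prime_def by blast
  then show ?thesis
    using assms(1) unfolding zero_prime_iff_weakly_prime[OF is_cring] I_prime_def
    by (metis DiffE)
qed

lemma (in ring) ideal_pow_Suc: "ideal_pow R P (Suc n) = ideal_pow R P n \<cdot> P"
  by (simp add: ideal_pow_def ideals_set_def)

lemma (in ring) ideal_pow_simps:
  assumes "ideal P R"
  shows "ideal_pow R P 1 = P" "ideal_pow R P 2 = P \<cdot> P" "ideal_pow R P 3 = P \<cdot> P \<cdot> P"
proof -
  have "carrier R \<cdot> P = P"
  proof
    show "carrier R \<cdot> P \<subseteq> P"
      using ideal_prod_inter[OF oneideal assms] by blast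
    show "P \<subseteq> carrier R \<cdot> P"
    proof
      fix x assume "x \<in> P"
      then show "x \<in> carrier R \<cdot> P"
        using ideal_prod.prod[of \<one> "carrier R" x P R] ideal.Icarr[OF assms] by simp
    qed
  qed
  then show 1: "ideal_pow R P 1 = P"
    using ideal_pow_Suc[of P 0] by (simp add: ideal_pow_def ideals_set_def)
  show 2: "ideal_pow R P 2 = P \<cdot> P"
    using ideal_pow_Suc[of P 1] 1 by (simp add: numeral_2_eq_2)
  show "ideal_pow R P 3 = P \<cdot> P \<cdot> P"
    using ideal_pow_Suc[of P 2] 2 by (simp add: eval_nat_numeral)
qed

lemma (in ring) ideal_pow_stable:
  assumes "ideal P R" "P \<cdot> P \<cdot> P = P \<cdot> P" "i \<ge> 2"
  shows "ideal_pow R P i = P \<cdot> P"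
  using assms(3)
  by (induction i rule: dec_induct) (simp_all add: ideal_pow_simps ideal_pow_Suc assms)

lemma (in cring) Inter_ideal_pow_stable:
  assumes "ideal P R" "P \<cdot> P \<cdot> P = P \<cdot> P"
  shows "(\<Inter>i\<in>{1..}. ideal_pow R P i) = P \<cdot> P"
proof
  show "(\<Inter>i\<in>{1..}. ideal_pow R P i) \<subseteq> P \<cdot> P"
    using ideal_pow_stable[OF assms, of 2] by fastforce
  show "P \<cdot> P \<subseteq> (\<Inter>i\<in>{1..}. ideal_pow R P i)"
  proof (rule INT_greatest)
    fix i :: nat assume "i \<in> {1..}"
    then consider "i = 1" | "i \<ge> 2" by fastforce
    then show "P \<cdot> P \<subseteq> ideal_pow R P i"
      using ideal_pow_stable[OF assms] ideal_pow_simps(1)[OF assms(1)]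
        ideal_prod_inter[OF assms(1) assms(1)]
      by cases auto
  qed
qed

lemma (in ring) idempotent_mem_ideal_pow:
  assumes "ideal P R" "x \<in> P" "x \<otimes> x = x"
  shows "x \<in> ideal_pow R P n"
proof (induction n)
  case 0
  then show ?case
    using assms ideal.Icarr by (simp add: ideal_pow_def ideals_set_def)
next
  case (Suc n)
  then show ?case
    using assms ideal_prod.prod[of x "ideal_pow R P n" x P R] by (simp add: ideal_pow_Suc)
qed

section \<open>Products of a weakly prime ideal with a whole ring\<close>

lemma RDirProd_cring:
  assumes "cring R" "cring S"
  shows "cring (RDirProd R S)"
proof (rule cring.intro)
  interpret R: cring R by fact
  interpret S: cring S by fact
  show "ring (RDirProd R S)"
    by (rule RDirProd_ring) unfold_locales
  then interpret RS: ring "RDirProd R S" .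
  show "comm_monoid (RDirProd R S)"
    by (rule RS.monoid_comm_monoidI)
      (auto simp: RDirProd_def DirProd_def monoid.defs R.m_comm S.m_comm)
qed

lemma RDirProd_ideal_left:
  assumes "cring R" "cring S" "ideal P R"
  shows "ideal (P \<times> carrier S) (RDirProd R S)"
proof (rule idealI)
  interpret R: cring R by fact
  interpret S: cring S by fact
  interpret P: ideal P R by fact
  interpret RS: cring "RDirProd R S"
    by (rule RDirProd_cring) fact+
  show "ring (RDirProd R S)" by unfold_locales
  have "subgroup (P \<times> carrier S) (add_monoid R \<times>\<times> add_monoid S)"
    by (intro DirProd_subgroups R.add.group_axioms S.add.group_axioms P.a_subgroup
        S.add.subgroup_self[simplified])
  then show "subgroup (P \<times> carrier S) (add_monoid (RDirProd R S))"
    by (simp only: RDirProd_add_monoid)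
qed (auto simp: RDirProd_def DirProd_def monoid.defs ideal.I_l_closed[OF assms(3)]
      ideal.I_r_closed[OF assms(3)] cring.cring_simprules[OF assms(2)])

lemma I_prime_times_carrier:
  assumes R: "cring R" and S: "cring S" and P: "zero_prime R P"
    and int: "(\<Inter>i\<in>{1..}. ideal_pow (RDirProd R S) (P \<times> carrier S) i)
               \<subseteq> ideal_prod (RDirProd R S) I (P \<times> carrier S)"
  shows "I_prime (RDirProd R S) I (P \<times> carrier S)"
proof -
  interpret R: cring R by fact
  interpret S: cring S by fact
  interpret RS: cring "RDirProd R S"
    by (rule RDirProd_cring) fact+
  have wp: "ideal P R" "P \<noteq> carrier R"
    "\<And>a b. \<lbrakk>a \<in> carrier R; b \<in> carrier R; a \<otimes>\<^bsub>R\<^esub> b \<noteq> \<zero>\<^bsub>R\<^esub>; a \<otimes>\<^bsub>R\<^esub> b \<in> P\<rbrakk> \<Longrightarrow> a \<in> P \<or> b \<in> P"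
    using P zero_prime_iff_weakly_prime[OF R] by blast+
  interpret P: ideal P R by (rule wp)
  have PS: "ideal (P \<times> carrier S) (RDirProd R S)"
    using R S wp(1) by (rule RDirProd_ideal_left)
  have pow: "(\<zero>\<^bsub>R\<^esub>, s) \<in> ideal_pow (RDirProd R S) (P \<times> carrier S) (Suc n)"
    if "s \<in> carrier S" for n s
  proof -
    \<comment> \<open>\<open>(0, 1)\<close> is idempotent, and \<open>(0, s) = (0, 1) (0, s)\<close>.\<close>
    have "(\<zero>\<^bsub>R\<^esub>, \<one>\<^bsub>S\<^esub>) \<in> ideal_pow (RDirProd R S) (P \<times> carrier S) n"
      by (rule RS.idempotent_mem_ideal_pow[OF PS])
        (auto simp: RDirProd_def DirProd_def monoid.defs)
    then have "(\<zero>\<^bsub>R\<^esub>, \<one>\<^bsub>S\<^esub>) \<otimes>\<^bsub>RDirProd R S\<^esub> (\<zero>\<^bsub>R\<^esub>, s)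
        \<in> ideal_prod (RDirProd R S) (ideal_pow (RDirProd R S) (P \<times> carrier S) n) (P \<times> carrier S)"
      by (rule ideal_prod.prod) (use that in auto)
    then show ?thesis
      using that by (simp add: RS.ideal_pow_Suc) (simp add: RDirProd_def DirProd_def monoid.defs)
  qed
  have zero_times: "(\<zero>\<^bsub>R\<^esub>, s) \<in> ideal_prod (RDirProd R S) I (P \<times> carrier S)"
    if "s \<in> carrier S" for s
  proof -
    have "(\<zero>\<^bsub>R\<^esub>, s) \<in> ideal_pow (RDirProd R S) (P \<times> carrier S) i" if "i \<ge> 1" for i
      using pow[OF \<open>s \<in> carrier S\<close>, of "i - 1"] that by simp
    then show ?thesis
      using int by auto
  qed
  have "P \<times> carrier S \<noteq> carrier (RDirProd R S)"
    using wp(2) S.zero_closed by (auto simp: RDirProd_carrier)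
  moreover have "x \<in> P \<times> carrier S \<or> y \<in> P \<times> carrier S"
    if xy: "x \<in> carrier (RDirProd R S)" "y \<in> carrier (RDirProd R S)"
      and prod: "x \<otimes>\<^bsub>RDirProd R S\<^esub> y \<in>
        P \<times> carrier S - ideal_prod (RDirProd R S) I (P \<times> carrier S)" for x y
  proof -
    obtain a s b t where ab: "x = (a, s)" "y = (b, t)"
      "a \<in> carrier R" "b \<in> carrier R" "s \<in> carrier S" "t \<in> carrier S"
      using xy by (auto simp: RDirProd_carrier)
    have mult: "x \<otimes>\<^bsub>RDirProd R S\<^esub> y = (a \<otimes>\<^bsub>R\<^esub> b, s \<otimes>\<^bsub>S\<^esub> t)"
      by (simp add: ab RDirProd_def DirProd_def monoid.defs)
    have "a \<otimes>\<^bsub>R\<^esub> b \<noteq> \<zero>\<^bsub>R\<^esub>" "a \<otimes>\<^bsub>R\<^esub> b \<in> P"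
      using prod zero_times[of "s \<otimes>\<^bsub>S\<^esub> t"] ab mult by auto
    then show ?thesis
      using wp(3) ab by auto
  qed
  ultimately show ?thesis
    unfolding I_prime_def using PS by (intro conjI ballI impI)
qed

section \<open>Finitely generated ideals with \<open>IP\<close> inside the cube of \<open>P\<close>\<close>

lemma (in cring) zero_prime_or_square_eq:
  assumes IP: "I_prime R I P" and I: "ideal I R" and sub: "I \<cdot> P \<subseteq> P \<cdot> P \<cdot> P"
  shows "zero_prime R P \<or> I \<cdot> P = P \<cdot> P \<and> P \<cdot> P \<cdot> P = P \<cdot> P"
proof (cases "\<exists>a\<in>carrier R. \<exists>b\<in>carrier R. a \<otimes> b \<in> P \<and> a \<notin> P \<and> b \<notin> P")
  case True
  have P: "ideal P R"
    using IP by (simp add: I_prime_def)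
  from True have "P \<cdot> P \<subseteq> I \<cdot> P"
    using I_prime_square_subset[OF IP I] by blast
  moreover have "P \<cdot> P \<cdot> P \<subseteq> P \<cdot> P"
    using ideal_prod_inter[OF ideal_prod_is_ideal[OF P P] P] by blast
  ultimately show ?thesis
    using sub by auto
next
  case False
  then show ?thesis
    using IP unfolding zero_prime_def I_prime_def by blast
qed

text \<open>
  The factor \<open>T\<close> generated by \<open>1 - e\<close> meets \<open>IP = (e)\<close> only in \<open>0\<close>, so a nonzero product inside
  \<open>P \<inter> T\<close> is automatically outside \<open>IP\<close>, where \<open>P\<close> behaves like a prime ideal. Properness of
  \<open>P \<inter> T\<close> in \<open>T\<close> comes from \<open>e \<in> P\<close>: if \<open>1 - e\<close> were in \<open>P\<close> as well, so would be \<open>1\<close>.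
\<close>

lemma (in cring) zero_prime_component:
  assumes IP: "I_prime R I P" and PI: "I \<cdot> P = PIdl e" and PP: "PIdl e \<subseteq> P"
    and e: "e \<in> carrier R" "e \<otimes> e = e"
  shows "zero_prime (ideal_as_ring R (PIdl (\<one> \<ominus> e)) (\<one> \<ominus> e)) (P \<inter> (PIdl (\<one> \<ominus> e)))"
    and "P = (P \<inter> (PIdl (\<one> \<ominus> e))) <+> (PIdl e)"
proof -
  let ?f = "\<one> \<ominus> e"
  let ?T = "ideal_as_ring R (PIdl ?f) ?f"
  have P: "ideal P R" "P \<noteq> carrier R"
    using IP by (auto simp: I_prime_def)
  interpret P: ideal P R by fact
  have f: "?f \<in> carrier R" using e by simp
  have iT: "ideal (PIdl ?f) R" and iS: "ideal (PIdl e) R"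
    using e by (auto intro: cgenideal_ideal)
  have unit: "?f \<in> PIdl ?f" "\<And>x. x \<in> PIdl ?f \<Longrightarrow> ?f \<otimes> x = x"
    using mem_cgenideal_idempotent_iff[OF f] idempotent_complement[OF e] f by auto
  have dec: "cring ?T" "(PIdl ?f) \<inter> (PIdl e) = {\<zero>}"
    using decomposes_as_idempotent[OF e] unfolding decomposes_as_def by auto
  have eP: "e \<in> P"
    using PP cgenideal_self[OF e(1)] by blast
  have "?f \<notin> P"
  proof
    assume "?f \<in> P"
    then have "\<one> \<in> P"
      using P.a_closed[OF eP] idempotent_complement(3)[OF e] by metis
    then show False
      using P.one_imp_carrier P(2) by simp
  qed
  then have "P \<inter> (PIdl ?f) \<noteq> carrier ?T"
    using unit(1) by auto
  moreover have "ideal (P \<inter> (PIdl ?f)) ?T"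
    by (rule ideal_ideal_as_ring[OF iT unit]) (auto intro: i_intersect P iT)
  moreover have "a \<in> P \<or> b \<in> P"
    if ab: "a \<in> PIdl ?f" "b \<in> PIdl ?f" "a \<otimes> b \<noteq> \<zero>" "a \<otimes> b \<in> P" for a b
  proof -
    have carr: "a \<in> carrier R" "b \<in> carrier R"
      using ab(1,2) ideal.Icarr[OF iT] by auto
    have "a \<otimes> b \<in> PIdl ?f"
      using ideal.I_r_closed[OF iT ab(1) carr(2)] .
    then have "a \<otimes> b \<notin> I \<cdot> P"
      using ab(3) dec(2) PI by auto
    then show ?thesis
      using IP ab(4) carr unfolding I_prime_def by blast
  qed
  ultimately show "zero_prime ?T (P \<inter> (PIdl ?f))"
    unfolding zero_prime_iff_weakly_prime[OF dec(1)] by simp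
  show "P = (P \<inter> (PIdl ?f)) <+> (PIdl e)"
  proof
    show "(P \<inter> (PIdl ?f)) <+> (PIdl e) \<subseteq> P"
      using PP by (auto simp: set_add_def')
    show "P \<subseteq> (P \<inter> (PIdl ?f)) <+> (PIdl e)"
    proof
      fix x assume x: "x \<in> P"
      then have xc: "x \<in> carrier R" by simp
      have "x = x \<otimes> ?f \<oplus> x \<otimes> e"
        using xc e(1) by algebra
      moreover have "x \<otimes> ?f \<in> P \<inter> (PIdl ?f)" "x \<otimes> e \<in> PIdl e"
        using x xc f P.I_r_closed unfolding cgenideal_def by auto
      ultimately show "x \<in> (P \<inter> (PIdl ?f)) <+> (PIdl e)"
        unfolding set_add_def' by blast
    qed
  qed
qed

lemma (in cring) fg_I_prime_decomposition:
  assumes fg: "finitely_generated_ideal R P" and I: "ideal I R" and IP: "I_prime R I P"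
    and eq: "I \<cdot> P = P \<cdot> P" "P \<cdot> P \<cdot> P = P \<cdot> P"
  shows "P \<cdot> P \<cdot> (P \<cdot> P) = P \<cdot> P"
    and "\<exists>e J. decomposes_as R e (PIdl (\<one> \<ominus> e)) (P \<cdot> P) \<and>
           zero_prime (ideal_as_ring R (PIdl (\<one> \<ominus> e)) (\<one> \<ominus> e)) J \<and> P = J <+> (P \<cdot> P)"
proof -
  have P: "ideal P R"
    using IP by (simp add: I_prime_def)
  show idem: "P \<cdot> P \<cdot> (P \<cdot> P) = P \<cdot> P"
    using ideal_prod_assoc[OF ideal_prod_is_ideal[OF P P] P P] eq(2) by simp
  obtain e where e: "e \<in> carrier R" "e \<otimes> e = e" "P \<cdot> P = PIdl e"
    using finitely_generated_idempotent_ideal_principal[OF finitely_generated_ideal_prod[OF fg fg] idem]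
    by blast
  have "PIdl e \<subseteq> P"
    using ideal_prod_inter[OF P P] e(3) by auto
  then show "\<exists>e J. decomposes_as R e (PIdl (\<one> \<ominus> e)) (P \<cdot> P) \<and>
           zero_prime (ideal_as_ring R (PIdl (\<one> \<ominus> e)) (\<one> \<ominus> e)) J \<and> P = J <+> (P \<cdot> P)"
    using zero_prime_component[OF IP _ _ e(1,2)] decomposes_as_idempotent[OF e(1,2)] e(3) eq(1)
    by metis
qed

theorem theorem2p8:
  shows
    "(\<forall>(R :: ('a, 'm) ring_scheme) (S :: ('b, 'n) ring_scheme) P.
        cring R \<and> cring S \<and> zero_prime R P \<longrightarrow>
        (\<forall>I. ideal I (RDirProd R S) \<and>
             (\<Inter>i\<in>{1..}. ideal_pow (RDirProd R S) (P \<times> carrier S) i)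
               \<subseteq> ideal_prod (RDirProd R S) I (P \<times> carrier S) \<and>
             ideal_prod (RDirProd R S) I (P \<times> carrier S) \<subseteq> P \<times> carrier S \<longrightarrow>
           I_prime (RDirProd R S) I (P \<times> carrier S)))
     \<and>
     (\<forall>(R :: ('c, 'k) ring_scheme) P I.
        cring R \<and> ideal P R \<and> P \<noteq> carrier R \<and> finitely_generated_ideal R P \<and>
        ideal I R \<and> I_prime R I P \<and> ideal_prod R I P \<subseteq> ideal_pow R P 3 \<longrightarrow>
        (zero_prime R P \<or>
         (ideal_pow R P 2 \<noteq> {\<zero>\<^bsub>R\<^esub>} \<and>
          ideal_pow R (ideal_pow R P 2) 2 = ideal_pow R P 2 \<and>
          (\<exists>e T S J. S = ideal_pow R P 2 \<and> decomposes_as R e T S \<and>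
             zero_prime (ideal_as_ring R T (\<one>\<^bsub>R\<^esub> \<ominus>\<^bsub>R\<^esub> e)) J \<and>
             P = J <+>\<^bsub>R\<^esub> S))) \<and>
        (\<forall>I'. ideal I' R \<and>
              (\<Inter>i\<in>{1..}. ideal_pow R P i) \<subseteq> ideal_prod R I' P \<and>
              ideal_prod R I' P \<subseteq> P \<longrightarrow>
            I_prime R I' P))"
proof (intro conjI allI impI; elim conjE)
  fix R :: "('a, 'm) ring_scheme" and S :: "('b, 'n) ring_scheme" and P I
  assume "cring R" "cring S" "zero_prime R P"
    "(\<Inter>i\<in>{1..}. ideal_pow (RDirProd R S) (P \<times> carrier S) i)
       \<subseteq> ideal_prod (RDirProd R S) I (P \<times> carrier S)"
  then show "I_prime (RDirProd R S) I (P \<times> carrier S)"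
    by (rule I_prime_times_carrier)
next
  fix R :: "('c, 'k) ring_scheme" and P I
  assume R: "cring R" and P: "ideal P R" and fg: "finitely_generated_ideal R P"
    and I: "ideal I R" and IP: "I_prime R I P" and sub: "ideal_prod R I P \<subseteq> ideal_pow R P 3"
  interpret cring R by fact
  note pow = ideal_pow_simps[OF P]
  have pow4: "ideal_pow R (P \<cdot>\<^bsub>R\<^esub> P) 2 = P \<cdot>\<^bsub>R\<^esub> P \<cdot>\<^bsub>R\<^esub> (P \<cdot>\<^bsub>R\<^esub> P)"
    by (rule ideal_pow_simps(2)[OF ideal_prod_is_ideal[OF P P]])
  have dichotomy: "zero_prime R P \<or> I \<cdot>\<^bsub>R\<^esub> P = P \<cdot>\<^bsub>R\<^esub> P \<and> P \<cdot>\<^bsub>R\<^esub> P \<cdot>\<^bsub>R\<^esub> P = P \<cdot>\<^bsub>R\<^esub> P"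
    using zero_prime_or_square_eq[OF IP I] sub pow(3) by simp
  show "zero_prime R P \<or>
         (ideal_pow R P 2 \<noteq> {\<zero>\<^bsub>R\<^esub>} \<and>
          ideal_pow R (ideal_pow R P 2) 2 = ideal_pow R P 2 \<and>
          (\<exists>e T S J. S = ideal_pow R P 2 \<and> decomposes_as R e T S \<and>
             zero_prime (ideal_as_ring R T (\<one>\<^bsub>R\<^esub> \<ominus>\<^bsub>R\<^esub> e)) J \<and>
             P = J <+>\<^bsub>R\<^esub> S))"
  proof (rule disj_imp[THEN iffD2], rule impI)
    assume nz: "\<not> zero_prime R P"
    then have eq: "I \<cdot>\<^bsub>R\<^esub> P = P \<cdot>\<^bsub>R\<^esub> P" "P \<cdot>\<^bsub>R\<^esub> P \<cdot>\<^bsub>R\<^esub> P = P \<cdot>\<^bsub>R\<^esub> P"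
      using dichotomy by auto
    have "P \<cdot>\<^bsub>R\<^esub> P \<noteq> {\<zero>\<^bsub>R\<^esub>}"
    proof
      assume zero: "P \<cdot>\<^bsub>R\<^esub> P = {\<zero>\<^bsub>R\<^esub>}"
      have "{\<zero>\<^bsub>R\<^esub>} \<cdot>\<^bsub>R\<^esub> P = {\<zero>\<^bsub>R\<^esub>}"
        using ideal_prod_commute[OF zeroideal P] ideal_prod_zero[OF P] by simp
      then show False
        using nz IP eq(1) zero unfolding zero_prime_def I_prime_def by simp
    qed
    then show "ideal_pow R P 2 \<noteq> {\<zero>\<^bsub>R\<^esub>} \<and>
          ideal_pow R (ideal_pow R P 2) 2 = ideal_pow R P 2 \<and>
          (\<exists>e T S J. S = ideal_pow R P 2 \<and> decomposes_as R e T S \<and>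
             zero_prime (ideal_as_ring R T (\<one>\<^bsub>R\<^esub> \<ominus>\<^bsub>R\<^esub> e)) J \<and>
             P = J <+>\<^bsub>R\<^esub> S)"
      unfolding pow pow4
      using fg_I_prime_decomposition[OF fg I IP eq] by blast
  qed
  show "I_prime R I' P"
    if I': "ideal I' R" and int: "(\<Inter>i\<in>{1..}. ideal_pow R P i) \<subseteq> I' \<cdot>\<^bsub>R\<^esub> P" for I'
  proof (cases "zero_prime R P")
    case True
    then show ?thesis
      using I' by (rule zero_prime_imp_I_prime)
  next
    case False
    then have "I \<cdot>\<^bsub>R\<^esub> P \<subseteq> I' \<cdot>\<^bsub>R\<^esub> P"
      using dichotomy Inter_ideal_pow_stable[OF P] int by auto
    then show ?thesis
      using IP unfolding I_prime_def by blast
  qed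
qed

end
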